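(* Let $f+g:X\times Y\to\mathbb R$, $(x,y)\mapsto f(x)+g(y)$, and assume that $\nabla(f+g):X\times Y\to X\times Y$ is $\alpha$-strongly monotone for some $\alpha>0$, i.e. $\langle\nabla(f+g)(u)-\nabla(f+g)(v),u-v\rangle_{X\times Y}\ge\alpha\|u-v\|_{X\times Y}^2$ for all $u,v\in X\times Y$. Assume the set $\Sigma$ of saddle points of $L$ is non-empty, and let $(x,y,\lambda):[0,+\infty)\to X\times Y\times Z$ be a solution of the generalized Arrow--Hurwicz differential system (GAH) with initial data $(x_0,y_0,\lambda_0)\in X\times Y\times Z$. Assume moreover that $(A\ B)^*:Z\to X\times Y$ is bounded from below, i.e. there exists $\beta>0$ such that $\|(A\ B)^*z\|_{X\times Y}^2\ge\beta\|z\|_Z^2$ for all $z\in Z$. Then, for $(\xi,\psi,\eta)\in\Sigma$ (the unique saddle point of $L$), $$L(x(t),y(t),\eta)-L(\xi,\psi,\lambda(t))=o\Big(\frac1t\Big)\quad\text{as } t\to+\infty,$$ $$\|(x(t),y(t),\lambda(t))-(\xi,\psi,\eta)\|=o\Big(\frac1{\sqrt t}\Big)\quad\text{as } t\to+\infty .$$ Consequently, $(x(t),y(t),\lambda(t))$ converges strongly, as $t\to+\infty$, to the unique element in $\Sigma$.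
   Context: $X$, $Y$, $Z$ are real Hilbert spaces; $X\times Y\times Z$ carries the product Hilbert structure $\langle\cdot,\cdot\rangle=\langle\cdot,\cdot\rangle_X+\langle\cdot,\cdot\rangle_Y+\langle\cdot,\cdot\rangle_Z$, with norm $\|\cdot\|$, and $X\times Y$ likewise carries the product structure. Standing assumptions: $f:X\to\mathbb R$ and $g:Y\to\mathbb R$ are convex and continuously differentiable; $\nabla f:X\to X$ and $\nabla g:Y\to Y$ are Lipschitz continuous on bounded sets; $A:X\to Z$ and $B:Y\to Z$ are linear and continuous, with adjoints $A^*,B^*$; $c\in Z$. $(A\ B):X\times Y\to Z$ denotes the operator $(x,y)\mapsto Ax+By$, so that $(A\ B)^*z=(A^*z,B^*z)$. The Lagrangian is $L:X\times Y\times Z\to\mathbb R$, $L(x,y,\lambda)=f(x)+g(y)+\langle\lambda,Ax+By-c\rangle_Z$. A saddle point of $L$ is a triple $(\bar x,\bar y,\bar\lambda)\in X\times Y\times Z$ with $L(\bar x,\bar y,\lambda)\le L(\bar x,\bar y,\bar\lambda)\le L(x,y,\bar\lambda)$ for all $(x,y,\lambda)\in X\times Y\times Z$; $\Sigma\subset X\times Y\times Z$ denotes the set of all saddle points of $L$. Under the hypotheses of the claim, $\Sigma$ consists of exactly one element. The system (GAH) is $$\dot x+\nabla f(x)+A^*\lambda=0_X,\qquad \dot y+\nabla g(y)+B^*\lambda=0_Y,\qquad \dot\lambda+c-Ax-By=0_Z,$$ with initial data $(x(0),y(0),\lambda(0))=(x_0,y_0,\lambda_0)\in X\times Y\times Z$;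 a solution is a function of class $\mathcal C^1$ on $[0,+\infty)$ with values in $X\times Y\times Z$ satisfying the system on $[0,+\infty)$ with these initial data. *)

theory Defs
  imports "HOL-Analysis.Analysis" "HOL-Library.Landau_Symbols"
begin

text \<open>
  A real Hilbert space is a type of sort \<open>{real_inner, complete_space}\<close>. The library's inner product
  and norm on product types are the ones of the product Hilbert structure. On Hilbert spaces, the
  library's \<^const>\<open>adjoint\<close> (stated by choice) of a continuous linear operator is the usual adjoint,
  by the Riesz representation theorem.
\<close>

text \<open>
  The gradient is the Riesz representative of the Frechet derivative; it is unique, and it exists
  whenever the function is differentiable on a Hilbert space.
\<close>
definition gradient :: "('a::{real_inner, complete_space} \<Rightarrow> real) \<Rightarrow> 'a \<Rightarrow> 'a" where
  "gradient f x = (THE D. GDERIV f x :> D)"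

text \<open>Continuity of the derivative is with respect to the operator norm.\<close>
definition continuously_differentiable :: "('a::real_normed_vector \<Rightarrow> real) \<Rightarrow> bool" where
  "continuously_differentiable f \<longleftrightarrow>
     (\<exists>f' :: 'a \<Rightarrow> 'a \<Rightarrow>\<^sub>L real.
        (\<forall>x. (f has_derivative blinfun_apply (f' x)) (at x)) \<and> continuous_on UNIV f')"

definition lipschitz_on_bounded_sets :: "('a::metric_space \<Rightarrow> 'b::metric_space) \<Rightarrow> bool" where
  "lipschitz_on_bounded_sets F \<longleftrightarrow> (\<forall>S. bounded S \<longrightarrow> (\<exists>C. C-lipschitz_on S F))"

definition strongly_monotone :: "real \<Rightarrow> ('a::real_inner \<Rightarrow> 'a) \<Rightarrow> bool" where
  "strongly_monotone \<alpha> F \<longleftrightarrow>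
     (\<forall>u v. inner (F u - F v) (u - v) \<ge> \<alpha> * (norm (u - v))\<^sup>2)"

definition lagrangian ::
  "('x \<Rightarrow> real) \<Rightarrow> ('y \<Rightarrow> real) \<Rightarrow> ('x \<Rightarrow> 'z) \<Rightarrow> ('y \<Rightarrow> 'z) \<Rightarrow> 'z \<Rightarrow> 'x \<Rightarrow> 'y \<Rightarrow> 'z::real_inner \<Rightarrow> real" where
  "lagrangian f g A B c x y l = f x + g y + inner l (A x + B y - c)"

definition saddle_points ::
  "('x \<Rightarrow> real) \<Rightarrow> ('y \<Rightarrow> real) \<Rightarrow> ('x \<Rightarrow> 'z) \<Rightarrow> ('y \<Rightarrow> 'z) \<Rightarrow> 'z \<Rightarrow> ('x \<times> 'y \<times> 'z::real_inner) set" where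
  "saddle_points f g A B c =
     {(\<xi>, \<psi>, \<eta>). \<forall>x y l.
        lagrangian f g A B c \<xi> \<psi> l \<le> lagrangian f g A B c \<xi> \<psi> \<eta> \<and>
        lagrangian f g A B c \<xi> \<psi> \<eta> \<le> lagrangian f g A B c x y \<eta>}"

text \<open>
  Trajectories are total functions on the reals of which only the values on \<open>[0, \<infinity>)\<close> matter:
  all derivatives are taken within \<open>[0, \<infinity>)\<close>, hence one-sided at \<open>0\<close>. (The library's
  \<^const>\<open>C1_differentiable_on\<close> asks for two-sided derivatives.)
\<close>
definition C1_on_halfline :: "(real \<Rightarrow> 'a::real_normed_vector) \<Rightarrow> bool" where
  "C1_on_halfline u \<longleftrightarrow>
     (\<exists>u'. (\<forall>t\<ge>0. (u has_vector_derivative u' t) (at t within {0..})) \<and> continuous_on {0..} u')"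

definition GAH_solution ::
  "('x \<Rightarrow> real) \<Rightarrow> ('y \<Rightarrow> real) \<Rightarrow> ('x \<Rightarrow> 'z) \<Rightarrow> ('y \<Rightarrow> 'z) \<Rightarrow> 'z \<Rightarrow> 'x \<Rightarrow> 'y \<Rightarrow> 'z \<Rightarrow>
   (real \<Rightarrow> 'x::{real_inner, complete_space}) \<Rightarrow>
   (real \<Rightarrow> 'y::{real_inner, complete_space}) \<Rightarrow>
   (real \<Rightarrow> 'z::{real_inner, complete_space}) \<Rightarrow> bool" where
  "GAH_solution f g A B c x0 y0 l0 x y l \<longleftrightarrow>
     C1_on_halfline (\<lambda>t. (x t, y t, l t)) \<and>
     (\<forall>t\<ge>0.
        vector_derivative x (at t within {0..}) + gradient f (x t) + adjoint A (l t) = 0 \<and>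
        vector_derivative y (at t within {0..}) + gradient g (y t) + adjoint B (l t) = 0 \<and>
        vector_derivative l (at t within {0..}) + c - A (x t) - B (y t) = 0) \<and>
     (x 0, y 0, l 0) = (x0, y0, l0)"

end

theory Submission
  imports Defs "HOL-Real_Asymp.Real_Asymp"
begin

text \<open>
  Write \<open>u = (x, y) - (\<xi>, \<psi>)\<close>, \<open>v = \<lambda> - \<eta>\<close>, \<open>K = (A B)\<close> and let \<open>G\<close> be the gradient of
  \<open>h(x, y) = f x + g y\<close>. The optimality conditions at the saddle point turn the system into
  \<open>u' = - F - K\<^sup>* v\<close>, \<open>v' = K u\<close> with \<open>F = G (x, y) - G (\<xi>, \<psi>)\<close>. The energy \<open>|u|\<^sup>2 + |v|\<^sup>2\<close> is
  nonincreasing, so the trajectory is bounded and \<open>|F| \<le> C |u|\<close> along it. Adding \<open>\<epsilon> \<langle>u, K\<^sup>* v\<rangle>\<close> to half of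
  the energy gives, for small \<open>\<epsilon>\<close>, a Lyapunov function \<open>E\<close> with \<open>E' \<le> - \<kappa> E\<close>: strong monotonicity
  controls \<open>u\<close> and the lower bound on \<open>K\<^sup>*\<close> controls \<open>v\<close>. Hence the decay is even exponential.
  By the mean value theorem the Lagrangian gap is \<open>\<langle>u, G ((\<xi>, \<psi>) + s u) - G (\<xi>, \<psi>)\<rangle>\<close> for some
  \<open>s \<in> (0, 1)\<close>, so it is at most \<open>C |u|\<^sup>2\<close> and decays exponentially as well.
\<close>

section \<open>Riesz representation and adjoints on Hilbert spaces\<close>

lemma riesz_representation:
  fixes \<phi> :: "'a::{real_inner, complete_space} \<Rightarrow> real"
  assumes "bounded_linear \<phi>"
  obtains z where "\<And>h. \<phi> h = inner h z"
proof -
  interpret bounded_linear \<phi> by fact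
  \<comment> \<open>The representative is the minimiser of \<open>q\<close>; the parallelogram law makes minimising sequences Cauchy.\<close>
  define q where "q x = inner x x / 2 - \<phi> x" for x
  obtain K where K: "\<And>x. norm (\<phi> x) \<le> norm x * K" using bounded by blast
  have lower: "- K\<^sup>2 / 2 \<le> q x" for x
  proof -
    have "\<phi> x \<le> norm x * K" using K[of x] by simp
    moreover have "0 \<le> (norm x - K)\<^sup>2" by simp
    ultimately show ?thesis
      by (simp add: q_def power2_diff power2_norm_eq_inner[symmetric])
  qed
  define m where "m = (INF x. q x)"
  have bdd: "bdd_below (range q)" using lower by (rule bdd_belowI2)
  have m_le: "m \<le> q x" for x unfolding m_def using bdd by (simp add: cINF_lower)
  have "\<exists>x. q x < m + 1 / Suc n" for n
    using cINF_less_iff[OF _ bdd, of "m + 1 / Suc n"] by (simp add: m_def)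
  then obtain X where X: "\<And>n. q (X n) < m + 1 / Suc n" by metis
  have para: "(norm (x - y))\<^sup>2 \<le> 4 * (q x + q y - 2 * m)" for x y
  proof -
    have "(norm (x - y))\<^sup>2 = 4 * (q x + q y - 2 * q ((1/2) *\<^sub>R (x + y)))"
      unfolding q_def power2_norm_eq_inner
      by (simp add: algebra_simps inner_commute add scaleR)
    then show ?thesis using m_le[of "(1/2) *\<^sub>R (x + y)"] by simp
  qed
  have "Cauchy X"
  proof (rule metric_CauchyI)
    fix e :: real assume "0 < e"
    \<comment> \<open>The bound \<open>para\<close> multiplies the sum of two excesses over
      \<open>m\<close> by 4, so excesses below \<open>e\<^sup>2 / 8\<close> give a squared distance
      below \<open>e\<^sup>2\<close>.\<close>
    then obtain N where N: "1 / real (Suc N) < e\<^sup>2 / 8"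
      using nat_approx_posE[of "e\<^sup>2 / 8"] by auto
    have small: "q (X n) < m + e\<^sup>2 / 8" if "n \<ge> N" for n
    proof -
      have "1 / real (Suc n) \<le> 1 / real (Suc N)" using that by (simp add: frac_le)
      then show ?thesis using X[of n] N by linarith
    qed
    have "dist (X i) (X j) < e" if "i \<ge> N" "j \<ge> N" for i j
    proof -
      have "q (X i) + q (X j) - 2 * m < e\<^sup>2 / 4"
        using small[OF that(1)] small[OF that(2)] by linarith
      then have "(norm (X i - X j))\<^sup>2 < e\<^sup>2" using para[of "X i" "X j"] by argo
      then show ?thesis using \<open>0 < e\<close> by (simp add: dist_norm power2_less_imp_less)
    qed
    then show "\<exists>M. \<forall>i\<ge>M. \<forall>j\<ge>M. dist (X i) (X j) < e" by blast
  qed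
  then obtain z where z: "X \<longlonglongrightarrow> z" by (auto simp: Cauchy_convergent_iff convergent_def)
  have "(\<lambda>n. q (X n)) \<longlonglongrightarrow> q z"
    unfolding q_def by (intro tendsto_intros z tendsto) simp
  moreover have "(\<lambda>n. m + 1 / Suc n) \<longlonglongrightarrow> m"
    by real_asymp
  ultimately have "q z \<le> m" using X by (meson LIMSEQ_le less_imp_le)
  then have min: "q z \<le> q x" for x using m_le[of x] by linarith
  have "\<phi> h = inner h z" for h
  proof (cases "h = 0")
    case True then show ?thesis by (simp add: zero)
  next
    case False
    define s where "s = inner z h - \<phi> h"
    \<comment> \<open>Along the line through \<open>z\<close> in direction \<open>h\<close>,
      \<open>q\<close> is a quadratic with slope \<open>s\<close> at \<open>z\<close>; the step
      \<open>- s / inner h h\<close> goes to its vertex. A strict decrease is impossible at the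
      minimiser, so the slope vanishes.\<close>
    have "q (z + (- s / inner h h) *\<^sub>R h) = q z - s\<^sup>2 / (2 * inner h h)"
      using False unfolding q_def s_def
      by (simp add: add diff scaleR inner_commute inner_add_left inner_add_right field_simps power2_eq_square)
    then have "s\<^sup>2 / (2 * inner h h) \<le> 0" using min[of "z + (- s / inner h h) *\<^sub>R h"] by simp
    moreover have "0 < inner h h" using False by simp
    ultimately have "s = 0" by (simp add: divide_le_0_iff)
    then show ?thesis by (simp add: s_def inner_commute)
  qed
  then show ?thesis using that by blast
qed

text \<open>Riesz, applied to the functional \<open>inner (T x) y\<close> of \<open>x\<close> for
  each fixed \<open>y\<close>, supplies the witness that makes the choice in \<open>adjoint\<close>
  meaningful. Only the domain has to be complete.\<close>

lemma inner_adjoint: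
  fixes T :: "'a::{real_inner, complete_space} \<Rightarrow> 'b::real_inner"
  assumes "bounded_linear T"
  shows "inner (T x) y = inner x (adjoint T y)"
proof -
  have "\<exists>z. \<forall>x. inner (T x) y = inner x z" for y
  proof -
    have "bounded_linear (\<lambda>x. inner (T x) y)"
      using assms by (rule bounded_linear_compose[OF bounded_linear_inner_left])
    then show ?thesis by (metis riesz_representation)
  qed
  then have "\<exists>T'. \<forall>x y. inner (T x) y = inner x (T' y)" by metis
  then have "\<forall>x y. inner (T x) y = inner x (adjoint T y)"
    unfolding adjoint_def by (rule someI_ex)
  then show ?thesis by blast
qed

text \<open>Linearity follows by testing against all vectors. For the bound, inserting
  \<open>adjoint T y\<close> itself as test vector and cancelling one factor of its norm yields the
  same constant as for \<open>T\<close>.\<close>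

lemma bounded_linear_adjoint:
  fixes T :: "'a::{real_inner, complete_space} \<Rightarrow> 'b::real_inner"
  assumes "bounded_linear T"
  shows "bounded_linear (adjoint T)"
proof -
  obtain K where "0 \<le> K" and K: "\<And>x. norm (T x) \<le> norm x * K"
    using bounded_linear.nonneg_bounded[OF assms] by blast
  have adj: "inner x (adjoint T y) = inner (T x) y" for x y
    using inner_adjoint[OF assms] by simp
  show ?thesis
  proof (rule bounded_linear_intro)
    fix y y' :: 'b and r :: real
    show "adjoint T (y + y') = adjoint T y + adjoint T y'"
      by (rule vector_eq_ldot[THEN iffD1]) (simp add: adj inner_add_right)
    show "adjoint T (r *\<^sub>R y) = r *\<^sub>R adjoint T y"
      by (rule vector_eq_ldot[THEN iffD1]) (simp add: adj)
    show "norm (adjoint T y) \<le> norm y * K"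
    proof (cases "adjoint T y = 0")
      case True
      then show ?thesis using \<open>0 \<le> K\<close> by simp
    next
      case False
      have "norm (adjoint T y) * norm (adjoint T y) = inner (T (adjoint T y)) y"
        by (simp add: adj[symmetric] power2_norm_eq_inner[symmetric] power2_eq_square)
      also have "\<dots> \<le> norm (T (adjoint T y)) * norm y" by (rule norm_cauchy_schwarz)
      also have "\<dots> \<le> norm (adjoint T y) * (norm y * K)"
        using mult_right_mono[OF K norm_ge_zero] by (simp add: mult_ac)
      finally show ?thesis using False by (simp)
    qed
  qed
qed

section \<open>Gradients: uniqueness, existence, minima and a mean value formula\<close>

lemma GDERIV_unique:
  assumes "GDERIV f x :> D" "GDERIV f x :> D'"
  shows "D = D'"
proof -
  have "(\<lambda>h. inner h D) = (\<lambda>h. inner h D')"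
    using assms unfolding gderiv_def by (rule has_derivative_unique)
  then have "\<forall>h. inner h D = inner h D'" by (simp add: fun_eq_iff)
  then show ?thesis by (simp only: vector_eq_ldot)
qed

text \<open>Riesz turns the derivative into an inner product with a fixed vector, and uniqueness
  then lets the definite description in \<open>gradient\<close> denote that vector.\<close>

lemma GDERIV_gradient:
  fixes f :: "'a::{real_inner, complete_space} \<Rightarrow> real"
  assumes "(f has_derivative f') (at x)"
  shows "GDERIV f x :> gradient f x"
proof -
  obtain D where D: "\<And>h. f' h = inner h D"
    using riesz_representation[OF has_derivative_bounded_linear[OF assms]] by blast
  then have ex: "GDERIV f x :> D" using assms by (simp add: gderiv_def flip: D)
  then have "gradient f x = D"
    unfolding gradient_def by (rule the_equality) (rule GDERIV_unique[OF _ ex])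
  with ex show ?thesis by simp
qed

lemma gradient_eqI: "GDERIV f x :> D \<Longrightarrow> gradient f x = D"
  using GDERIV_unique GDERIV_gradient[OF gderiv_def[THEN iffD1]] by blast

lemma gradient_eq_zero_at_min:
  fixes f :: "'a::{real_inner, complete_space} \<Rightarrow> real"
  assumes "GDERIV f x :> D" and "\<And>y. f x \<le> f y"
  shows "D = 0"
proof -
  have "(\<lambda>h. inner h D) = (\<lambda>h. 0)"
    using assms by (intro has_derivative_local_min[of f]) (auto simp: gderiv_def)
  then have "inner D D = 0" by (rule fun_cong)
  then show ?thesis by simp
qed

text \<open>The scalar mean value theorem on the segment from \<open>a\<close> to
  \<open>a + u\<close>. It requires no continuity of \<open>G\<close>.\<close>

lemma GDERIV_mean_value:
  fixes f :: "'a::real_inner \<Rightarrow> real"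
  assumes "\<And>x. GDERIV f x :> G x"
  obtains s where "0 < s" "s < 1" "f (a + u) - f a = inner u (G (a + s *\<^sub>R u))"
proof -
  have "((\<lambda>s. f (a + s *\<^sub>R u)) has_real_derivative inner u (G (a + s *\<^sub>R u))) (at s)" for s
  proof -
    have line: "((\<lambda>s. a + s *\<^sub>R u) has_derivative (\<lambda>r. r *\<^sub>R u)) (at s)"
      by (auto intro!: derivative_eq_intros)
    have "((\<lambda>s. f (a + s *\<^sub>R u)) has_derivative (\<lambda>r. inner (r *\<^sub>R u) (G (a + s *\<^sub>R u)))) (at s)"
      using has_derivative_compose[OF line assms[unfolded gderiv_def]] .
    then show ?thesis by (rule has_derivative_imp_has_field_derivative) simp
  qed
  then have "\<exists>s>0. s < 1 \<and> f (a + 1 *\<^sub>R u) - f (a + 0 *\<^sub>R u) = (1 - 0) * inner u (G (a + s *\<^sub>R u))"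
    by (intro MVT2) auto
  then obtain s where "0 < s" "s < 1" "f (a + u) - f a = inner u (G (a + s *\<^sub>R u))" by auto
  then show ?thesis by (rule that)
qed

section \<open>Boundedness and exponential decay for the abstract system
  \<open>u' = - F - K' v\<close>, \<open>v' = K u\<close>\<close>

lemma nonincreasing_on_halfline:
  fixes f :: "real \<Rightarrow> real"
  assumes "\<And>t. 0 \<le> t \<Longrightarrow> (f has_real_derivative f' t) (at t within {0..})"
    and "\<And>t. 0 \<le> t \<Longrightarrow> f' t \<le> 0" and "0 \<le> t"
  shows "f t \<le> f 0"
proof (rule DERIV_nonpos_imp_decreasing_open[OF \<open>0 \<le> t\<close>])
  fix s :: real assume "0 < s"
  \<comment> \<open>At interior points the one-sided derivative is the usual one; at the endpoint 0
    continuity is enough.\<close>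
  then have "at s within {0::real..} = at s" by (intro at_within_interior) simp
  then show "\<exists>y. DERIV f s :> y \<and> y \<le> 0" using assms(1,2)[of s] \<open>0 < s\<close> by auto
next
  have "continuous_on {0..} f" using assms(1) by (intro DERIV_continuous_on[of _ f f']) auto
  then show "continuous_on {0..t} f" by (rule continuous_on_subset) auto
qed

lemma has_real_derivative_inner:
  assumes "(u has_vector_derivative u') (at t within S)" "(v has_vector_derivative v') (at t within S)"
  shows "((\<lambda>t. inner (u t) (v t)) has_real_derivative inner (u t) v' + inner u' (v t)) (at t within S)"
  unfolding has_real_derivative_iff_has_vector_derivative
  using assms by (rule bounded_bilinear.has_vector_derivative[OF bounded_bilinear_inner])

text \<open>The coupling terms cancel because \<open>K'\<close> is adjoint to \<open>K\<close>,
  which leaves the derivative \<open>- 2 * inner (F s) (u s)\<close>. This a priori bound confines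
  the trajectory to a ball, on which a Lipschitz constant becomes available.\<close>

lemma primal_dual_bounded:
  fixes u F :: "real \<Rightarrow> 'a::real_inner" and v :: "real \<Rightarrow> 'b::real_inner"
  assumes adj: "\<And>a b. inner (K a) b = inner a (K' b)"
    and du: "\<And>t. 0 \<le> t \<Longrightarrow> (u has_vector_derivative - F t - K' (v t)) (at t within {0..})"
    and dv: "\<And>t. 0 \<le> t \<Longrightarrow> (v has_vector_derivative K (u t)) (at t within {0..})"
    and mono: "\<And>t. 0 \<le> t \<Longrightarrow> 0 \<le> inner (F t) (u t)" and "0 \<le> t"
  shows "(norm (u t))\<^sup>2 + (norm (v t))\<^sup>2 \<le> (norm (u 0))\<^sup>2 + (norm (v 0))\<^sup>2"
proof -
  define N where "N t = inner (u t) (u t) + inner (v t) (v t)" for t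
  have "N t \<le> N 0"
  proof (rule nonincreasing_on_halfline[OF _ _ \<open>0 \<le> t\<close>])
    fix s :: real assume s: "0 \<le> s"
    show "(N has_real_derivative - 2 * inner (F s) (u s)) (at s within {0..})"
      unfolding N_def
      by (rule DERIV_cong[OF DERIV_add[OF has_real_derivative_inner[OF du[OF s] du[OF s]]
            has_real_derivative_inner[OF dv[OF s] dv[OF s]]]])
        (simp add: inner_diff_left inner_diff_right inner_commute adj[symmetric])
    show "- 2 * inner (F s) (u s) \<le> 0" using mono[OF s] by simp
  qed
  then show ?thesis by (simp add: N_def power2_norm_eq_inner)
qed

text \<open>The linear bound on \<open>F\<close> is asked only along the trajectory, so a Lipschitz
  constant on a ball containing the trajectory provides it.\<close>

lemma primal_dual_exponential_decay:
  fixes u F :: "real \<Rightarrow> 'a::real_inner" and v :: "real \<Rightarrow> 'b::real_inner"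
  assumes K: "bounded_linear K" and K': "bounded_linear K'"
    and adj: "\<And>a b. inner (K a) b = inner a (K' b)"
    and du: "\<And>t. 0 \<le> t \<Longrightarrow> (u has_vector_derivative - F t - K' (v t)) (at t within {0..})"
    and dv: "\<And>t. 0 \<le> t \<Longrightarrow> (v has_vector_derivative K (u t)) (at t within {0..})"
    and mono: "\<And>t. 0 \<le> t \<Longrightarrow> inner (F t) (u t) \<ge> \<alpha> * (norm (u t))\<^sup>2" and "0 < \<alpha>"
    and lip: "\<And>t. 0 \<le> t \<Longrightarrow> norm (F t) \<le> C * norm (u t)"
    and coercive: "\<And>z. \<beta> * (norm z)\<^sup>2 \<le> (norm (K' z))\<^sup>2" and "0 < \<beta>"
  obtains M \<kappa> where "0 < \<kappa>" "\<And>t. 0 \<le> t \<Longrightarrow> (norm (u t))\<^sup>2 + (norm (v t))\<^sup>2 \<le> M * exp (- \<kappa> * t)"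
proof -
  obtain m where m: "0 < m" "\<And>a. norm (K a) \<le> norm a * m" using bounded_linear.pos_bounded[OF K] by blast
  obtain m' where m': "0 < m'" "\<And>a. norm (K' a) \<le> norm a * m'" using bounded_linear.pos_bounded[OF K'] by blast
  \<comment> \<open>The first bound keeps the cross term below a quarter of \<open>N\<close>, so
    that \<open>E\<close> and \<open>N\<close> are comparable. The second lets the new terms in
    \<open>u\<close> consume at most half of the dissipation \<alpha>.\<close>
  define \<epsilon> where "\<epsilon> = min (1 / (2 * m')) (\<alpha> / (C\<^sup>2 + 2 * m\<^sup>2))"
  have den: "0 < C\<^sup>2 + 2 * m\<^sup>2" using m(1) by (simp add: add_nonneg_pos)
  have eps: "0 < \<epsilon>" using m'(1) den \<open>0 < \<alpha>\<close> by (simp add: \<epsilon>_def)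
  have eps1: "\<epsilon> * m' \<le> 1 / 2"
  proof -
    have "\<epsilon> \<le> 1 / (2 * m')" by (simp add: \<epsilon>_def)
    then show ?thesis using m'(1) by (simp add: field_simps)
  qed
  have eps2: "\<epsilon> * (C\<^sup>2 / 2 + m\<^sup>2) \<le> \<alpha> / 2"
  proof -
    have "\<epsilon> \<le> \<alpha> / (C\<^sup>2 + 2 * m\<^sup>2)" by (simp add: \<epsilon>_def)
    then show ?thesis using den by (simp add: field_simps)
  qed
  \<comment> \<open>The two entries are the dissipation rates that remain for \<open>u\<close> and
    for \<open>v\<close>.\<close>
  define \<kappa> where "\<kappa> = min (\<alpha> / 2) (\<epsilon> * \<beta> / 2)"
  have kap1: "\<kappa> \<le> \<alpha> / 2" and kap2: "\<kappa> \<le> \<epsilon> * \<beta> / 2" by (simp_all add: \<kappa>_def)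
  have kap: "0 < \<kappa>" using \<open>0 < \<alpha>\<close> \<open>0 < \<beta>\<close> eps by (simp add: \<kappa>_def)
  define N where "N t = (norm (u t))\<^sup>2 + (norm (v t))\<^sup>2" for t
  \<comment> \<open>The energy \<open>N / 2\<close> alone only dissipates in \<open>u\<close>; the cross term transfers dissipation to \<open>v\<close>.\<close>
  define E where "E t = (inner (u t) (u t) + inner (v t) (v t)) / 2 + \<epsilon> * inner (u t) (K' (v t))" for t
  \<comment> \<open>This is the derivative of \<open>E\<close> along the system, after the coupling
    terms of the energy have cancelled.\<close>
  define D where "D t = - inner (F t) (u t)
      + \<epsilon> * (inner (u t) (K' (K (u t))) - inner (F t) (K' (v t)) - (norm (K' (v t)))\<^sup>2)" for t
  have dE: "(E has_real_derivative D t) (at t within {0..})" if "0 \<le> t" for t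
  proof -
    note 1 = has_real_derivative_inner[OF du[OF that] du[OF that]]
    note 2 = has_real_derivative_inner[OF dv[OF that] dv[OF that]]
    note 3 = has_real_derivative_inner[OF du[OF that] bounded_linear.has_vector_derivative[OF K' dv[OF that]]]
    show ?thesis unfolding E_def
      by (rule DERIV_cong[OF DERIV_add[OF DERIV_cdivide[OF DERIV_add[OF 1 2], of 2] DERIV_cmult[OF 3, of \<epsilon>]]])
        (simp add: D_def inner_diff_left inner_diff_right inner_commute adj[symmetric] power2_norm_eq_inner
          linear_neg[OF bounded_linear.linear[OF K]] algebra_simps)
  qed
  have cross: "\<bar>\<epsilon> * inner (u t) (K' (v t))\<bar> \<le> N t / 4" for t
  proof -
    have "\<bar>inner (u t) (K' (v t))\<bar> \<le> norm (u t) * norm (K' (v t))" by (rule Cauchy_Schwarz_ineq2)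
    also have "\<dots> \<le> norm (u t) * (norm (v t) * m')" by (simp add: m'(2) mult_left_mono)
    also have "\<dots> = m' * (norm (u t) * norm (v t))" by simp
    also have "\<dots> \<le> m' * (N t / 2)"
      using m'(1) sum_squares_bound[of "norm (u t)" "norm (v t)"] by (intro mult_left_mono) (auto simp: N_def)
    finally have "\<bar>\<epsilon> * inner (u t) (K' (v t))\<bar> \<le> \<epsilon> * (m' * (N t / 2))"
      using eps by (simp add: abs_mult)
    also have "\<dots> = (\<epsilon> * m') * (N t / 2)" by simp
    also have "\<dots> \<le> 1 / 2 * (N t / 2)" using eps1 by (rule mult_right_mono) (simp add: N_def)
    finally show ?thesis by simp
  qed
  have E_eq: "E t = N t / 2 + \<epsilon> * inner (u t) (K' (v t))" for t
    by (simp add: E_def N_def power2_norm_eq_inner)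
  have N_le: "N t \<le> 4 * E t" and E_le: "E t \<le> N t" for t
  proof -
    have "0 \<le> N t" by (simp add: N_def)
    then show "N t \<le> 4 * E t" "E t \<le> N t" using cross[of t] E_eq[of t] by linarith+
  qed
  have D_le: "D t \<le> - \<kappa> * E t" if "0 \<le> t" for t
  proof -
    have "inner (u t) (K' (K (u t))) = (norm (K (u t)))\<^sup>2"
      by (simp add: adj[symmetric] power2_norm_eq_inner)
    also have "\<dots> \<le> (norm (u t) * m)\<^sup>2" using m(2) by (intro power_mono) auto
    finally have a: "inner (u t) (K' (K (u t))) \<le> m\<^sup>2 * (norm (u t))\<^sup>2" by (simp add: power_mult_distrib mult.commute)
    \<comment> \<open>Young's inequality spends half of the dissipation
      \<open>(norm (K' (v t)))\<^sup>2\<close>. The other half carries the lower bound on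
      \<open>K'\<close>, whence \<beta> / 2 below.\<close>
    have "- inner (F t) (K' (v t)) \<le> norm (F t) * norm (K' (v t))"
      using Cauchy_Schwarz_ineq2[of "F t" "K' (v t)"] by linarith
    also have "\<dots> \<le> (C * norm (u t)) * norm (K' (v t))" by (simp add: lip that mult_right_mono)
    also have "\<dots> \<le> (C * norm (u t))\<^sup>2 / 2 + (norm (K' (v t)))\<^sup>2 / 2"
      using sum_squares_bound[of "C * norm (u t)" "norm (K' (v t))"] by simp
    finally have b: "- inner (F t) (K' (v t)) \<le> C\<^sup>2 / 2 * (norm (u t))\<^sup>2 + (norm (K' (v t)))\<^sup>2 / 2"
      by (simp add: power_mult_distrib)
    have "D t \<le> - \<alpha> * (norm (u t))\<^sup>2
        + \<epsilon> * ((C\<^sup>2 / 2 + m\<^sup>2) * (norm (u t))\<^sup>2 - \<beta> / 2 * (norm (v t))\<^sup>2)"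
      unfolding D_def using mono[OF that] a b coercive[of "v t"] eps
      by (intro add_mono mult_left_mono) (auto simp: algebra_simps)
    also have "\<dots> = - \<alpha> * (norm (u t))\<^sup>2 + (\<epsilon> * (C\<^sup>2 / 2 + m\<^sup>2)) * (norm (u t))\<^sup>2 - (\<epsilon> * \<beta> / 2) * (norm (v t))\<^sup>2"
      by (simp add: algebra_simps)
    also have "\<dots> \<le> - \<alpha> * (norm (u t))\<^sup>2 + \<alpha> / 2 * (norm (u t))\<^sup>2 - (\<epsilon> * \<beta> / 2) * (norm (v t))\<^sup>2"
      using mult_right_mono[OF eps2, of "(norm (u t))\<^sup>2"] by simp
    also have "\<dots> \<le> - \<kappa> * N t"
      using mult_right_mono[OF kap1, of "(norm (u t))\<^sup>2"] mult_right_mono[OF kap2, of "(norm (v t))\<^sup>2"]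
      by (simp add: N_def algebra_simps)
    also have "\<dots> \<le> - \<kappa> * E t" using kap E_le by simp
    finally show ?thesis .
  qed
  have "N t \<le> 4 * E 0 * exp (- \<kappa> * t)" if "0 \<le> t" for t
  proof -
    \<comment> \<open>Gronwall's argument: the integrating factor turns the differential inequality
      for \<open>E\<close> into monotonicity.\<close>
    have "exp (\<kappa> * t) * E t \<le> exp (\<kappa> * 0) * E 0"
    proof (rule nonincreasing_on_halfline[OF _ _ that])
      fix s :: real assume "0 \<le> s"
      show "((\<lambda>t. exp (\<kappa> * t) * E t) has_real_derivative exp (\<kappa> * s) * (\<kappa> * E s + D s)) (at s within {0..})"
        by (auto intro!: derivative_eq_intros dE[OF \<open>0 \<le> s\<close>] simp: algebra_simps)
      show "exp (\<kappa> * s) * (\<kappa> * E s + D s) \<le> 0"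
        using D_le[OF \<open>0 \<le> s\<close>] by (simp add: mult_nonneg_nonpos)
    qed
    then have "E t \<le> E 0 * exp (- \<kappa> * t)" by (simp add: exp_minus field_simps)
    then show ?thesis using N_le[of t] by linarith
  qed
  then show ?thesis using that[OF kap] unfolding N_def by blast
qed

section \<open>Lipschitz bounds on products, components of a trajectory, and little-o rates\<close>

lemma lipschitz_on_bounded_sets_map_prod:
  assumes "lipschitz_on_bounded_sets F" "lipschitz_on_bounded_sets G"
  shows "lipschitz_on_bounded_sets (\<lambda>p. (F (fst p), G (snd p)))"
  unfolding lipschitz_on_bounded_sets_def
proof (intro allI impI)
  fix S :: "('a \<times> 'c) set" assume "bounded S"
  then obtain C D where C: "C-lipschitz_on (fst ` S) F" and D: "D-lipschitz_on (snd ` S) G"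
    using assms bounded_fst bounded_snd unfolding lipschitz_on_bounded_sets_def by meson
  have "1-lipschitz_on S (fst :: 'a \<times> 'c \<Rightarrow> 'a)" "1-lipschitz_on S (snd :: 'a \<times> 'c \<Rightarrow> 'c)"
    by (simp_all add: lipschitz_on_def dist_fst_le dist_snd_le)
  then have "(C * 1)-lipschitz_on S (\<lambda>p. F (fst p))" "(D * 1)-lipschitz_on S (\<lambda>p. G (snd p))"
    using C D by (blast intro: lipschitz_on_compose2)+
  then show "\<exists>C. C-lipschitz_on S (\<lambda>p. (F (fst p), G (snd p)))"
    using lipschitz_on_Pair by blast
qed

text \<open>\<open>vector_derivative\<close> is a choice, so identifying it with a given derivative
  requires uniqueness, hence a nontrivial filter. This holds even at \<open>t = 0\<close>, because
  the half-line contains a right neighbourhood of \<open>t\<close>.\<close>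

lemma halfline_components:
  assumes "((\<lambda>t. (x t, y t, l t)) has_vector_derivative d) (at t within {0..})" and "0 \<le> (t::real)"
  shows "(x has_vector_derivative vector_derivative x (at t within {0..})) (at t within {0..})"
    and "(y has_vector_derivative vector_derivative y (at t within {0..})) (at t within {0..})"
    and "(l has_vector_derivative vector_derivative l (at t within {0..})) (at t within {0..})"
proof -
  have "at t within {0..} \<noteq> bot"
  proof -
    have "at_right t \<le> at t within {0..}" using \<open>0 \<le> t\<close> by (intro at_le) auto
    then show ?thesis using trivial_limit_at_right_real[of t] by (metis le_bot)
  qed
  moreover have "(x has_vector_derivative fst d) (at t within {0..})"
    using bounded_linear.has_vector_derivative[OF bounded_linear_fst assms(1)] by simp
  moreover have "(y has_vector_derivative fst (snd d)) (at t within {0..})"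
    using bounded_linear.has_vector_derivative[OF
        bounded_linear_compose[OF bounded_linear_fst bounded_linear_snd] assms(1)] by simp
  moreover have "(l has_vector_derivative snd (snd d)) (at t within {0..})"
    using bounded_linear.has_vector_derivative[OF
        bounded_linear_compose[OF bounded_linear_snd bounded_linear_snd] assms(1)] by simp
  ultimately show "(x has_vector_derivative vector_derivative x (at t within {0..})) (at t within {0..})"
    and "(y has_vector_derivative vector_derivative y (at t within {0..})) (at t within {0..})"
    and "(l has_vector_derivative vector_derivative l (at t within {0..})) (at t within {0..})"
    by (simp_all add: vector_derivative_within)
qed

lemma exp_decay_smallo:
  fixes \<phi> :: "real \<Rightarrow> real"
  assumes "0 < \<kappa>" and "\<And>t. 0 \<le> t \<Longrightarrow> \<bar>\<phi> t\<bar> \<le> M * exp (- \<kappa> * t)"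
  shows "\<phi> \<in> o[at_top](\<lambda>t. 1 / t)" "\<phi> \<in> o[at_top](\<lambda>t. 1 / sqrt t)"
proof -
  have "\<phi> \<in> O[at_top](\<lambda>t. exp (- \<kappa> * t))"
    using assms(2) by (intro bigoI[of _ M] eventually_at_top_linorderI[of 0]) auto
  moreover have "(\<lambda>t. exp (- \<kappa> * t)) \<in> o[at_top](\<lambda>t. 1 / t)"
    and "(\<lambda>t. exp (- \<kappa> * t)) \<in> o[at_top](\<lambda>t. 1 / sqrt t)"
    using \<open>0 < \<kappa>\<close> by real_asymp+
  ultimately show "\<phi> \<in> o[at_top](\<lambda>t. 1 / t)" "\<phi> \<in> o[at_top](\<lambda>t. 1 / sqrt t)"
    using landau_o.big_small_trans by blast+
qed

lemma tendsto_of_norm_diff_smallo: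
  fixes p :: "real \<Rightarrow> 'a::real_normed_vector"
  assumes "(\<lambda>t. norm (p t - q)) \<in> o[at_top](\<lambda>t. 1 / sqrt t)"
  shows "(p \<longlongrightarrow> q) at_top"
proof -
  have "(\<lambda>t. 1 / sqrt t) \<in> o[at_top](\<lambda>_. 1)" by real_asymp
  then have "(\<lambda>t. norm (p t - q)) \<in> o[at_top](\<lambda>_. 1)" using assms landau_o.small_trans by blast
  then have "((\<lambda>t. norm (p t - q)) \<longlongrightarrow> 0) at_top" by (auto dest: smalloD_tendsto)
  then show ?thesis by (simp add: tendsto_norm_zero_iff LIM_zero_cancel)
qed

section \<open>Gradient of the separable sum and optimality conditions at a saddle point\<close>

lemma GDERIV_gradient_C1:
  assumes "continuously_differentiable f"
  shows "GDERIV f x :> gradient f x"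
  using assms GDERIV_gradient unfolding continuously_differentiable_def by blast

lemma GDERIV_separable_sum:
  assumes "GDERIV f (fst p) :> D" "GDERIV g (snd p) :> D'"
  shows "GDERIV (\<lambda>(u, v). f u + g v) p :> (D, D')"
proof -
  have "((\<lambda>q. f (fst q)) has_derivative (\<lambda>h. inner (fst h) D)) (at p)"
    using has_derivative_compose[OF has_derivative_fst[OF has_derivative_ident], of f] assms(1)
    by (simp add: gderiv_def)
  moreover have "((\<lambda>q. g (snd q)) has_derivative (\<lambda>h. inner (snd h) D')) (at p)"
    using has_derivative_compose[OF has_derivative_snd[OF has_derivative_ident], of g] assms(2)
    by (simp add: gderiv_def)
  ultimately show ?thesis
    unfolding gderiv_def case_prod_beta inner_prod_def fst_conv snd_conv by (rule has_derivative_add)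
qed

lemma adjoint_row_operator:
  fixes A :: "'x::{real_inner, complete_space} \<Rightarrow> 'z::real_inner"
    and B :: "'y::{real_inner, complete_space} \<Rightarrow> 'z"
  assumes "bounded_linear A" "bounded_linear B"
  shows "adjoint (\<lambda>(u, v). A u + B v) = (\<lambda>z. (adjoint A z, adjoint B z))"
  using assms by (intro adjoint_unique) (auto simp: inner_add_left inner_adjoint)

text \<open>Freezing the multiplier and one primal variable leaves \<open>f\<close> or
  \<open>g\<close> plus an affine function, minimal at the saddle point, so its gradient vanishes
  there.\<close>

lemma saddle_point_conditions:
  fixes A :: "'x::{real_inner, complete_space} \<Rightarrow> 'z::real_inner"
    and B :: "'y::{real_inner, complete_space} \<Rightarrow> 'z"
  assumes "bounded_linear A" "bounded_linear B"
    and f: "\<And>x. GDERIV f x :> gradient f x" and g: "\<And>y. GDERIV g y :> gradient g y"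
    and saddle: "(\<xi>, \<psi>, \<eta>) \<in> saddle_points f g A B c"
  shows "gradient f \<xi> + adjoint A \<eta> = 0" "gradient g \<psi> + adjoint B \<eta> = 0" "A \<xi> + B \<psi> = c"
proof -
  have max: "lagrangian f g A B c \<xi> \<psi> l \<le> lagrangian f g A B c \<xi> \<psi> \<eta>"
    and min: "lagrangian f g A B c \<xi> \<psi> \<eta> \<le> lagrangian f g A B c x y \<eta>" for x y l
    using saddle by (auto simp: saddle_points_def)
  have affine: "GDERIV (\<lambda>x. inner \<eta> (T x + b)) p :> adjoint T \<eta>"
    if "bounded_linear T" for T :: "'c::{real_inner, complete_space} \<Rightarrow> 'z" and b p
  proof -
    have "((\<lambda>x. inner \<eta> (T x + b)) has_derivative (\<lambda>h. inner \<eta> (T h))) (at p)"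
      by (auto intro!: derivative_eq_intros bounded_linear_imp_has_derivative that)
    then show ?thesis by (simp add: gderiv_def inner_adjoint[OF that, symmetric] inner_commute)
  qed
  have "GDERIV (\<lambda>x. f x + inner \<eta> (A x + (B \<psi> - c))) \<xi> :> gradient f \<xi> + adjoint A \<eta>"
    using assms(1) by (intro GDERIV_add f affine)
  then show "gradient f \<xi> + adjoint A \<eta> = 0"
    by (rule gradient_eq_zero_at_min) (use min[of _ \<psi>] in \<open>simp add: lagrangian_def algebra_simps\<close>)
  have "GDERIV (\<lambda>y. g y + inner \<eta> (B y + (A \<xi> - c))) \<psi> :> gradient g \<psi> + adjoint B \<eta>"
    using assms(2) by (intro GDERIV_add g affine)
  then show "gradient g \<psi> + adjoint B \<eta> = 0"
    by (rule gradient_eq_zero_at_min) (use min[of \<xi>] in \<open>simp add: lagrangian_def algebra_simps\<close>)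
  \<comment> \<open>Shifting the multiplier by the constraint residual raises the Lagrangian by the
    squared norm of that residual; maximality at \<eta> forces it to be zero.\<close>
  have "inner (A \<xi> + B \<psi> - c) (A \<xi> + B \<psi> - c) \<le> 0"
    using max[of "\<eta> + (A \<xi> + B \<psi> - c)"] by (simp add: lagrangian_def inner_add_left)
  then show "A \<xi> + B \<psi> = c" by (metis inner_gt_zero_iff not_le right_minus_eq)
qed

theorem corollary5p4:
  fixes f :: "'x::{real_inner, complete_space} \<Rightarrow> real"
    and g :: "'y::{real_inner, complete_space} \<Rightarrow> real"
    and A :: "'x \<Rightarrow> 'z::{real_inner, complete_space}"
    and B :: "'y \<Rightarrow> 'z"
    and c :: 'z
    and \<alpha> \<beta> :: real
    and x0 :: 'x and y0 :: 'y and l0 :: 'z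
    and x :: "real \<Rightarrow> 'x" and y :: "real \<Rightarrow> 'y" and l :: "real \<Rightarrow> 'z"
  assumes "convex_on UNIV f" and "convex_on UNIV g"
    and "continuously_differentiable f" and "continuously_differentiable g"
    and "lipschitz_on_bounded_sets (gradient f)" and "lipschitz_on_bounded_sets (gradient g)"
    and "bounded_linear A" and "bounded_linear B"
    and "\<alpha> > 0" and "strongly_monotone \<alpha> (gradient (\<lambda>(u, v). f u + g v))"
    and "saddle_points f g A B c \<noteq> {}"
    and "GAH_solution f g A B c x0 y0 l0 x y l"
    and "\<beta> > 0"
    and "\<And>z. (norm (adjoint (\<lambda>(u, v). A u + B v) z))\<^sup>2 \<ge> \<beta> * (norm z)\<^sup>2"
  shows "\<exists>\<xi> \<psi> \<eta>. saddle_points f g A B c = {(\<xi>, \<psi>, \<eta>)} \<and>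
    (\<lambda>t. lagrangian f g A B c (x t) (y t) \<eta> - lagrangian f g A B c \<xi> \<psi> (l t))
      \<in> o[at_top](\<lambda>t. 1 / t) \<and>
    (\<lambda>t. norm ((x t, y t, l t) - (\<xi>, \<psi>, \<eta>))) \<in> o[at_top](\<lambda>t. 1 / sqrt t) \<and>
    ((\<lambda>t. (x t, y t, l t)) \<longlongrightarrow> (\<xi>, \<psi>, \<eta>)) at_top"
proof -
  define h where "h = (\<lambda>(u, v). f u + g v)"
  define G where "G p = (gradient f (fst p), gradient g (snd p))" for p
  define K where "K = (\<lambda>(u, v). A u + B v)"
  define K' where "K' = (\<lambda>z. (adjoint A z, adjoint B z))"
  have f: "GDERIV f p :> gradient f p" for p using assms(3) by (rule GDERIV_gradient_C1)
  have g: "GDERIV g p :> gradient g p" for p using assms(4) by (rule GDERIV_gradient_C1)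
  have h: "GDERIV h p :> G p" for p
    unfolding h_def G_def by (intro GDERIV_separable_sum f g)
  have "gradient h = G" using gradient_eqI[OF h] by blast
  then have strong: "inner (G p - G q) (p - q) \<ge> \<alpha> * (norm (p - q))\<^sup>2" for p q
    using assms(10) unfolding h_def strongly_monotone_def by metis
  have K: "bounded_linear K"
    unfolding K_def case_prod_beta
    using assms(7,8) by (intro bounded_linear_add bounded_linear_compose[OF assms(7) bounded_linear_fst]
        bounded_linear_compose[OF assms(8) bounded_linear_snd])
  have adjK: "adjoint K = K'"
    unfolding K_def K'_def using assms(7,8) by (rule adjoint_row_operator)
  have K': "bounded_linear K'" using bounded_linear_adjoint[OF K] by (simp add: adjK)
  interpret K: bounded_linear K by (rule K)
  interpret K': bounded_linear K' by (rule K')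
  have adj: "inner (K p) z = inner p (K' z)" for p z using inner_adjoint[OF K] by (simp add: adjK)
  have coercive: "\<beta> * (norm z)\<^sup>2 \<le> (norm (K' z))\<^sup>2" for z
    using assms(14)[of z] unfolding K_def[symmetric] adjK .
  have saddle: "G (a, b) + K' e = 0" "K (a, b) = c" if "(a, b, e) \<in> saddle_points f g A B c" for a b e
    using saddle_point_conditions[OF assms(7,8) f g that] by (auto simp: G_def K'_def K_def zero_prod_def)
  obtain \<xi> \<psi> \<eta> where sp: "(\<xi>, \<psi>, \<eta>) \<in> saddle_points f g A B c" using assms(11) by auto
  note opt = saddle[OF sp]

  \<comment> \<open>The difference of two optimality conditions is tested with the primal
    difference. \<open>K\<close> annihilates that difference, so strong monotonicity makes it zero;
    then \<open>K' (e - \<eta>) = 0\<close>, and the lower bound on \<open>K'\<close> identifies the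
    multipliers.\<close>
  have "(a, b, e) = (\<xi>, \<psi>, \<eta>)" if "(a, b, e) \<in> saddle_points f g A B c" for a b e
  proof -
    note opt' = saddle[OF that]
    have G: "G (a, b) = - K' e" "G (\<xi>, \<psi>) = - K' \<eta>"
      using opt(1) opt'(1) by (simp_all add: eq_neg_iff_add_eq_0)
    have "G (a, b) - G (\<xi>, \<psi>) = - K' (e - \<eta>)" using G by (simp add: K'.diff)
    then have "inner ((a, b) - (\<xi>, \<psi>)) (G (a, b) - G (\<xi>, \<psi>)) = - inner (K ((a, b) - (\<xi>, \<psi>))) (e - \<eta>)"
      by (simp only: inner_minus_right adj)
    also have "K ((a, b) - (\<xi>, \<psi>)) = 0" using opt(2) opt'(2) by (simp only: K.diff diff_self)
    finally have "\<alpha> * (norm ((a, b) - (\<xi>, \<psi>)))\<^sup>2 \<le> 0"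
      using strong[of "(a, b)" "(\<xi>, \<psi>)"] by (simp only: inner_commute inner_zero_left minus_zero)
    then have "(norm ((a, b) - (\<xi>, \<psi>)))\<^sup>2 \<le> 0" using \<open>\<alpha> > 0\<close> by (simp only: mult_le_0_iff) linarith
    then have eq: "(a, b) = (\<xi>, \<psi>)" by (simp only: power2_less_eq_zero_iff norm_eq_zero right_minus_eq)
    then have "K' (e - \<eta>) = 0" using G unfolding K'.diff by (metis neg_equal_iff_equal right_minus_eq)
    then have "\<beta> * (norm (e - \<eta>))\<^sup>2 \<le> 0" using coercive[of "e - \<eta>"] by simp
    then have "(norm (e - \<eta>))\<^sup>2 \<le> 0" using \<open>\<beta> > 0\<close> by (simp only: mult_le_0_iff) linarith
    then have "e = \<eta>" by (simp only: power2_less_eq_zero_iff norm_eq_zero right_minus_eq)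
    with eq show ?thesis by blast
  qed
  then have "p = (\<xi>, \<psi>, \<eta>)" if "p \<in> saddle_points f g A B c" for p
    using that by (cases p) blast
  then have unique: "saddle_points f g A B c = {(\<xi>, \<psi>, \<eta>)}" using sp by blast

  \<comment> \<open>Centring at the saddle point brings the trajectory into the form of the abstract
    system.\<close>
  define u where "u t = (x t, y t) - (\<xi>, \<psi>)" for t
  define v where "v t = l t - \<eta>" for t
  define F where "F t = G (x t, y t) - G (\<xi>, \<psi>)" for t
  have "C1_on_halfline (\<lambda>t. (x t, y t, l t))"
    and sys: "\<And>t. 0 \<le> t \<Longrightarrow>
        vector_derivative x (at t within {0..}) + gradient f (x t) + adjoint A (l t) = 0 \<and>
        vector_derivative y (at t within {0..}) + gradient g (y t) + adjoint B (l t) = 0 \<and>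
        vector_derivative l (at t within {0..}) + c - A (x t) - B (y t) = 0"
    using assms(12) by (auto simp: GAH_solution_def)
  then obtain w' where w': "\<And>t. 0 \<le> t \<Longrightarrow> ((\<lambda>t. (x t, y t, l t)) has_vector_derivative w' t) (at t within {0..})"
    by (auto simp: C1_on_halfline_def)
  have du: "(u has_vector_derivative - F t - K' (v t)) (at t within {0..})" if "0 \<le> t" for t
  proof -
    have "(vector_derivative x (at t within {0..}), vector_derivative y (at t within {0..})) = - F t - K' (v t)"
    proof -
      have "vector_derivative x (at t within {0..}) = - gradient f (x t) - adjoint A (l t)"
        and "vector_derivative y (at t within {0..}) = - gradient g (y t) - adjoint B (l t)"
        using sys[OF that] by (simp_all add: add.assoc eq_neg_iff_add_eq_0[symmetric])
      then have "(vector_derivative x (at t within {0..}), vector_derivative y (at t within {0..}))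
          = - G (x t, y t) - K' (l t)"
        by (simp add: G_def K'_def)
      moreover have "G (\<xi>, \<psi>) = - K' \<eta>" using opt(1) by (simp add: eq_neg_iff_add_eq_0)
      ultimately show ?thesis by (simp add: F_def v_def K'.diff)
    qed
    then show ?thesis
      unfolding u_def
      using has_vector_derivative_diff[OF has_vector_derivative_Pair[OF halfline_components(1,2)[OF w'[OF that] that]]
          has_vector_derivative_const] by (simp del: diff_Pair)
  qed
  have dv: "(v has_vector_derivative K (u t)) (at t within {0..})" if "0 \<le> t" for t
  proof -
    have "vector_derivative l (at t within {0..}) = K (u t)"
      using sys[OF that] opt(2) by (simp add: u_def K.diff del: diff_Pair) (simp add: K_def algebra_simps)
    then show ?thesis
      unfolding v_def
      using has_vector_derivative_diff[OF halfline_components(3)[OF w'[OF that] that] has_vector_derivative_const]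
      by simp
  qed
  have mono: "inner (F t) (u t) \<ge> \<alpha> * (norm (u t))\<^sup>2" for t
    unfolding F_def u_def by (rule strong)
  have mono0: "0 \<le> inner (F t) (u t)" for t
    using mono[of t] \<open>\<alpha> > 0\<close> by (meson mult_nonneg_nonneg less_imp_le order_trans zero_le_power2)

  \<comment> \<open>The initial distance to the saddle point; it bounds the primal part for all
    times and fixes the ball that yields \<open>C\<close>.\<close>
  define R where "R = sqrt ((norm (u 0))\<^sup>2 + (norm (v 0))\<^sup>2)"
  have bound: "norm (u t) \<le> R" if "0 \<le> t" for t
  proof -
    have "(norm (u t))\<^sup>2 \<le> (norm (u 0))\<^sup>2 + (norm (v 0))\<^sup>2"
      using primal_dual_bounded[OF adj du dv mono0 that] zero_le_power2[of "norm (v t)"] by linarith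
    then show ?thesis unfolding R_def by (rule real_le_rsqrt)
  qed
  have "lipschitz_on_bounded_sets G"
    using lipschitz_on_bounded_sets_map_prod[OF assms(5,6)] by (simp add: G_def[abs_def])
  then obtain C where C: "C-lipschitz_on (cball (\<xi>, \<psi>) R) G"
    unfolding lipschitz_on_bounded_sets_def using bounded_cball by blast
  \<comment> \<open>The estimate is stated for every displacement \<open>d\<close> in the ball,
    since it serves both for \<open>u t\<close> and for the intermediate point
    \<open>s *\<^sub>R u t\<close> of the mean value formula.\<close>
  have lip: "norm (G ((\<xi>, \<psi>) + d) - G (\<xi>, \<psi>)) \<le> C * norm d" if "norm d \<le> R" for d
    using lipschitz_onD[OF C, of "(\<xi>, \<psi>) + d" "(\<xi>, \<psi>)"] that order_trans[OF norm_ge_zero that]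
    by (simp add: dist_norm del: add_Pair)
  have u_plus: "(\<xi>, \<psi>) + u t = (x t, y t)" for t by (simp add: u_def)
  have lipF: "norm (F t) \<le> C * norm (u t)" if "0 \<le> t" for t
    using lip[OF bound[OF that]] unfolding u_plus F_def .
  obtain M \<kappa> where \<kappa>: "0 < \<kappa>"
    and decay: "\<And>t. 0 \<le> t \<Longrightarrow> (norm (u t))\<^sup>2 + (norm (v t))\<^sup>2 \<le> M * exp (- \<kappa> * t)"
    using primal_dual_exponential_decay[OF K K' adj du dv mono \<open>\<alpha> > 0\<close> lipF coercive \<open>\<beta> > 0\<close>] by blast
  have C0: "0 \<le> C" using C by (rule lipschitz_on_nonneg)

  have gap: "\<bar>lagrangian f g A B c (x t) (y t) \<eta> - lagrangian f g A B c \<xi> \<psi> (l t)\<bar> \<le> (C * M) * exp (- \<kappa> * t)"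
    if "0 \<le> t" for t
  proof -
    obtain s where s: "0 < s" "s < 1"
      and mv: "h ((\<xi>, \<psi>) + u t) - h (\<xi>, \<psi>) = inner (u t) (G ((\<xi>, \<psi>) + s *\<^sub>R u t))"
      using GDERIV_mean_value[OF h] by metis
    \<comment> \<open>The term with \<open>l t\<close> vanishes by feasibility of the saddle point,
      so the gap depends on the primal error alone.\<close>
    have "lagrangian f g A B c (x t) (y t) \<eta> - lagrangian f g A B c \<xi> \<psi> (l t)
        = h (x t, y t) - h (\<xi>, \<psi>) + inner \<eta> (K (x t, y t) - c) - inner (l t) (K (\<xi>, \<psi>) - c)"
      by (simp add: lagrangian_def h_def K_def)
    also have "\<dots> = h ((\<xi>, \<psi>) + u t) - h (\<xi>, \<psi>) + inner (K (u t)) \<eta>"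
      using opt(2) by (simp add: u_plus inner_commute) (simp add: u_def K.diff del: diff_Pair)
    also have "\<dots> = inner (u t) (G ((\<xi>, \<psi>) + s *\<^sub>R u t) + K' \<eta>)"
      by (simp add: mv adj inner_add_right)
    also have "K' \<eta> = - G (\<xi>, \<psi>)" using opt(1) by (simp add: eq_neg_iff_add_eq_0 add.commute)
    finally have "\<bar>lagrangian f g A B c (x t) (y t) \<eta> - lagrangian f g A B c \<xi> \<psi> (l t)\<bar>
        \<le> norm (u t) * norm (G ((\<xi>, \<psi>) + s *\<^sub>R u t) - G (\<xi>, \<psi>))"
      using Cauchy_Schwarz_ineq2[of "u t"] by simp
    also have "\<dots> \<le> norm (u t) * (C * norm (s *\<^sub>R u t))"
      using s bound[OF that] mult_left_le_one_le[of "norm (u t)" s] by (intro mult_left_mono lip) auto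
    also have "\<dots> \<le> norm (u t) * (C * norm (u t))"
      using s C0 mult_left_le_one_le[of "norm (u t)" s] by (intro mult_left_mono) auto
    also have "\<dots> = C * (norm (u t))\<^sup>2" by (simp add: power2_eq_square)
    also have "\<dots> \<le> C * (M * exp (- \<kappa> * t))"
    proof (rule mult_left_mono[OF _ C0])
      show "(norm (u t))\<^sup>2 \<le> M * exp (- \<kappa> * t)"
        using decay[OF that] zero_le_power2[of "norm (v t)"] by linarith
    qed
    finally show ?thesis by (simp only: mult.assoc)
  qed

  \<comment> \<open>The square root halves the exponent, which still beats every power of
    \<open>t\<close>.\<close>
  have dist: "\<bar>norm ((x t, y t, l t) - (\<xi>, \<psi>, \<eta>))\<bar> \<le> sqrt M * exp (- (\<kappa> / 2) * t)" if "0 \<le> t" for t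
  proof -
    have "norm ((x t, y t, l t) - (\<xi>, \<psi>, \<eta>)) = sqrt ((norm (u t))\<^sup>2 + (norm (v t))\<^sup>2)"
      by (simp add: u_def v_def norm_Pair add.assoc)
    also have "\<dots> \<le> sqrt (M * exp (- \<kappa> * t))" using decay[OF that] by simp
    also have "exp (- \<kappa> * t) = (exp (- (\<kappa> / 2) * t))\<^sup>2" by (simp add: exp_double[symmetric])
    finally show ?thesis by (simp add: real_sqrt_mult)
  qed
  have rate: "(\<lambda>t. norm ((x t, y t, l t) - (\<xi>, \<psi>, \<eta>))) \<in> o[at_top](\<lambda>t. 1 / sqrt t)"
    using \<kappa> dist by (intro exp_decay_smallo(2)[of "\<kappa> / 2"]) auto
  show ?thesis
    using unique exp_decay_smallo(1)[OF \<kappa> gap] rate tendsto_of_norm_diff_smallo[OF rate] by blast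
qed

end
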